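(* Let $\gamma>0$ be fixed, and for a distribution $F$ let $G$ be the distribution with tail $\overline G(x)=1$ for $x<0$ and $\overline G(x)=\overline F(x)e^{-\gamma x}$ for $x\ge0$. If $F$ belongs to the class $\mathcal{D}_f\setminus\mathcal{S}^*$, then $G\in(\mathcal{J}\cap\mathcal{K}^c)\setminus\big(\bigcup_{\beta>0}\mathcal{S}(\beta)\big)$.
   Context: All distributions are probability distributions $F$ with unbounded support contained in $[0,\infty)$; $\overline F:=1-F$ is the tail and $F^{*2}=F*F$ the two-fold convolution. Asymptotic relations are as $x\to\infty$; $g\sim h$ means $g(x)/h(x)\to1$, and $g=O(h)$ means $\limsup g(x)/h(x)<\infty$. Class $\mathcal{J}$: $F\in\mathcal{J}$ iff, for i.i.d. $X_1,X_2,\dots$ with distribution $F$, $S_n=\sum_{i=1}^n X_i$ and $X_{n,1}=\max_{1\le i\le n}X_i$, one has for all $n\ge2$ (equivalently, for $n=2$) $\lim_{K\to\infty}\liminf_{x\to\infty}\mathbb{P}(X_{n,1}>x-K\mid S_n>x)=1$. Class $\mathcal{K}$ (heavy-tailed): $\int_0^\infty e^{\lambda y}F(dy)=\infty$ for all $\lambda>0$. $\mathcal{K}^c$ (light-tailed) is its complement. Class $\mathcal{D}$ (dominatedly varying): $\overline F(tx)=O(\overline F(x))$ for all (equivalently, for some) $t\in(0,1)$. $\mathcal{D}_f$ is the class of distributions in $\mathcal{D}$ with finite mean. Class $\mathcal{S}^*$ (strongly subexponential): $F\in\mathcal{K}$, $F$ has finite mean $\mu>0$, and $\limsup_{x\to\infty}\frac{1}{\overline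 F(x)}\int_0^x\overline F(x-y)\overline F(y)\,dy=2\mu$. For $\beta>0$, $F\in\mathcal{L}(\beta)$ iff $\overline F(x+t)\sim e^{-\beta t}\overline F(x)$ for all $t\ne0$; and $F\in\mathcal{S}(\beta)$ (convolution equivalent) iff $F\in\mathcal{L}(\beta)$, $\int_0^\infty e^{\beta y}F(dy)<\infty$ and $\overline{F^{*2}}(x)\sim2\int_0^\infty e^{\beta y}F(dy)\,\overline F(x)$. *)

theory Defs
  imports "HOL-Probability.Probability" "HOL-Real_Asymp.Real_Asymp"
begin

unbundle asymp_equiv_syntax

definition tail :: "real measure \<Rightarrow> real \<Rightarrow> real" where
  "tail F x = 1 - cdf F x"

text \<open>Given that the support is contained in \<open>[0,\<infinity>)\<close>, it is unbounded iff the tail never vanishes.\<close>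

definition dists :: "real measure set" where
  "dists = {F. real_distribution F \<and> measure F {..<0} = 0 \<and> (\<forall>x. tail F x > 0)}"

definition exp_moment :: "real measure \<Rightarrow> real \<Rightarrow> ennreal" where
  "exp_moment F l = (\<integral>\<^sup>+y\<in>{0..}. ennreal (exp (l * y)) \<partial>F)"

text \<open>The i.i.d. variables \<open>X\<^sub>1, \<dots>, X\<^sub>n\<close> are realised as the coordinates \<open>X i\<close> of the \<open>n\<close>-fold product
  measure. The outer limit is a limit of extended reals.\<close>

definition big_jump_prob :: "real measure \<Rightarrow> nat \<Rightarrow> real \<Rightarrow> real \<Rightarrow> real" where
  "big_jump_prob F n K x =
     \<P>(X in (\<Pi>\<^sub>M i\<in>{1..n}. F). (MAX i\<in>{1..n}. X i) > x - K \<bar> (\<Sum>i\<in>{1..n}. X i) > x)"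

definition class_J :: "real measure set" where
  "class_J = {F \<in> dists. \<forall>n\<ge>2.
     ((\<lambda>K. Liminf at_top (\<lambda>x. ereal (big_jump_prob F n K x))) \<longlongrightarrow> 1) at_top}"

definition class_K :: "real measure set" where
  "class_K = {F \<in> dists. \<forall>l>0. exp_moment F l = \<infinity>}"

definition light_tailed :: "real measure set" where
  "light_tailed = dists - class_K"

definition class_D :: "real measure set" where
  "class_D = {F \<in> dists. \<forall>t\<in>{0<..<1}. (\<lambda>x. tail F (t * x)) \<in> O[at_top](tail F)}"

definition finite_mean :: "real measure \<Rightarrow> bool" where
  "finite_mean F \<longleftrightarrow> integrable F (\<lambda>y. y)"

definition mean :: "real measure \<Rightarrow> real" where
  "mean F = (\<integral>y. y \<partial>F)"

definition class_Df :: "real measure set" where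
  "class_Df = {F \<in> class_D. finite_mean F}"

definition class_S_star :: "real measure set" where
  "class_S_star = {F \<in> class_K. finite_mean F \<and> mean F > 0 \<and>
     Limsup at_top (\<lambda>x. ereal ((LINT y:{0..x}|lborel. tail F (x - y) * tail F y) / tail F x))
       = ereal (2 * mean F)}"

definition class_L :: "real \<Rightarrow> real measure set" where
  "class_L \<beta> = {F \<in> dists. \<forall>t. t \<noteq> 0 \<longrightarrow>
     (\<lambda>x. tail F (x + t)) \<sim>[at_top] (\<lambda>x. exp (- \<beta> * t) * tail F x)}"

definition class_S :: "real \<Rightarrow> real measure set" where
  "class_S \<beta> = {F \<in> class_L \<beta>. exp_moment F \<beta> < \<infinity> \<and>
     tail (F \<star> F) \<sim>[at_top] (\<lambda>x. 2 * enn2real (exp_moment F \<beta>) * tail F x)}"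

definition is_tilt :: "real \<Rightarrow> real measure \<Rightarrow> real measure \<Rightarrow> bool" where
  "is_tilt \<gamma> F G \<longleftrightarrow> real_distribution G \<and>
     (\<forall>x<0. tail G x = 1) \<and> (\<forall>x\<ge>0. tail G x = tail F x * exp (- \<gamma> * x))"

lemma ex1_is_tilt:
  assumes "\<gamma> > 0" "F \<in> dists"
  shows "\<exists>!G. is_tilt \<gamma> F G"
proof (rule ex_ex1I)
  interpret F: real_distribution F using assms by (simp add: dists_def)
  define H where "H x = (if x < 0 then 0 else 1 - tail F x * exp (- \<gamma> * x))" for x
  have tail01: "0 \<le> tail F x" "tail F x \<le> 1" for x
    by (auto simp: tail_def F.cdf_bounded_prob F.cdf_nonneg)
  have anti: "tail F y \<le> tail F x" if "x \<le> y" for x y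
    using that by (simp add: tail_def F.cdf_nondecreasing)
  have H01: "0 \<le> H x" for x
    using tail01[of x] assms(1) by (auto simp: H_def intro!: mult_le_one)
  have mono: "H x \<le> H y" if "x \<le> y" for x y
  proof (cases "x < 0")
    case True
    then show ?thesis using H01[of y] by (simp add: H_def)
  next
    case False
    have "tail F y * exp (- \<gamma> * y) \<le> tail F x * exp (- \<gamma> * x)"
      using that assms(1) tail01 anti by (intro mult_mono) auto
    then show ?thesis using False that by (simp add: H_def)
  qed
  have rc: "continuous (at_right a) H" for a
  proof (cases "a < 0")
    case True
    have "\<forall>\<^sub>F x in at_right a. H x = 0"
      using eventually_at_right_less[of a] eventually_at_right_real[OF True]
      by eventually_elim (auto simp: H_def)
    then show ?thesis
      using True by (simp add: continuous_within H_def tendsto_eventually)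
  next
    case False
    have "((\<lambda>x. 1 - tail F x * exp (- \<gamma> * x)) \<longlongrightarrow> 1 - tail F a * exp (- \<gamma> * a)) (at_right a)"
      using F.cdf_is_right_cont[of a] unfolding tail_def continuous_within
      by (intro tendsto_intros)
    moreover have "\<forall>\<^sub>F x in at_right a. 1 - tail F x * exp (- \<gamma> * x) = H x"
      using eventually_at_right_less[of a] by eventually_elim (use False in \<open>auto simp: H_def\<close>)
    ultimately have "(H \<longlongrightarrow> 1 - tail F a * exp (- \<gamma> * a)) (at_right a)"
      by (rule Lim_transform_eventually)
    then show ?thesis using False by (simp add: continuous_within H_def)
  qed
  have bot: "(H \<longlongrightarrow> 0) at_bot"
  proof (rule tendsto_eventually)
    show "\<forall>\<^sub>F x in at_bot. H x = 0"
      using eventually_gt_at_bot[of "0::real"] by eventually_elim (simp add: H_def)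
  qed
  have "((\<lambda>x. 1 - tail F x * exp (- \<gamma> * x)) \<longlongrightarrow> 1 - (1 - 1) * 0) at_top"
    unfolding tail_def
  proof (intro tendsto_intros F.cdf_lim_at_top_prob)
    show "((\<lambda>x. exp (- \<gamma> * x)) \<longlongrightarrow> 0) at_top"
      using assms(1) by real_asymp
  qed
  moreover have "\<forall>\<^sub>F x in at_top. 1 - tail F x * exp (- \<gamma> * x) = H x"
    using eventually_ge_at_top[of 0] by eventually_elim (simp add: H_def)
  ultimately have "(H \<longlongrightarrow> 1 - (1 - 1) * 0) at_top"
    by (rule Lim_transform_eventually)
  then have top: "(H \<longlongrightarrow> 1) at_top" by simp
  have "cdf (interval_measure H) = H"
    by (intro ext) (simp add: cdf_def measure_interval_measure_Iic[OF mono rc bot])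
  moreover have "real_distribution (interval_measure H)"
    using mono rc bot top by (rule real_distribution_interval_measure)
  ultimately have "is_tilt \<gamma> F (interval_measure H)"
    by (auto simp: is_tilt_def tail_def[of "interval_measure H"] H_def)
  then show "\<exists>G. is_tilt \<gamma> F G" ..
next
  fix G G' assume *: "is_tilt \<gamma> F G" "is_tilt \<gamma> F G'"
  have "tail G x = tail G' x" for x
    using * by (cases "x < 0") (auto simp: is_tilt_def)
  then have "cdf G = cdf G'" by (auto simp: tail_def fun_eq_iff)
  then show "G = G'" using * by (intro cdf_unique) (auto simp: is_tilt_def)
qed

end

(* The tilt turns the finite mean of F into a finite exponential moment of G at gamma, so G is
   light-tailed. If S_n > x but no summand exceeds x - K, then some X_i exceeds x/n and x - T, where
   the sum T of the other summands exceeds K. Conditioning on T and using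
   tail F (x/n) = O(tail F x), this has probability at most
   const * tail G x * E[exp (gamma T); T > K], whereas P(S_n > x) >= tail G x; the expectation
   vanishes as K grows, so G is in J.
   If G were in S(beta), then tail F (x + t) / tail F x would tend to exp ((gamma - beta) t).
   Monotonicity of the tail excludes beta < gamma, and beta > gamma would make the tail of F
   exponentially small, which dominated variation forbids. For beta = gamma the distribution F is
   long-tailed, and dominated convergence on [0, x/2] puts it in S*, against the hypothesis. *)
theory Submission imports Defs begin

section \<open>Tails, the layer-cake formula and exponential moments\<close>

lemma (in real_distribution) tail_eq_prob: "tail M x = prob {x<..}"
proof -
  have "prob (space M - {..x}) = 1 - prob {..x}"
    by (rule prob_compl) simp
  moreover have "space M - {..x} = {x<..}" by auto
  ultimately show ?thesis by (simp add: tail_def cdf_def)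
qed

lemma (in real_distribution) tail_antimono: "x \<le> y \<Longrightarrow> tail M y \<le> tail M x"
  by (simp add: tail_def cdf_nondecreasing)

lemma (in real_distribution) tail_bounds: "0 \<le> tail M x" "tail M x \<le> 1"
  by (simp_all add: tail_eq_prob)

lemma (in real_distribution) borel_measurable_tail [measurable]: "tail M \<in> borel_measurable borel"
proof -
  have "mono (\<lambda>x. - tail M x)" by (simp add: mono_def tail_antimono)
  then have "(\<lambda>x. - (- tail M x)) \<in> borel_measurable borel"
    by (intro borel_measurable_uminus borel_measurable_mono)
  then show ?thesis by simp
qed

text \<open>Tonelli on the region \<open>0 \<le> t < y\<close>, whose section at fixed
  \<open>t\<close> has measure \<open>tail M t\<close>. Taking \<open>h = 1\<close> yields the mean,
  and \<open>h t = \<gamma> * exp (\<gamma> * t)\<close> the exponential moment.\<close>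

lemma (in real_distribution) nn_integral_layer_cake:
  fixes h :: "real \<Rightarrow> ennreal"
  assumes [measurable]: "h \<in> borel_measurable borel"
  shows "(\<integral>\<^sup>+y. (\<integral>\<^sup>+t. h t * indicator {0..<y} t \<partial>lborel) \<partial>M)
    = (\<integral>\<^sup>+t. h t * ennreal (tail M t) * indicator {0..} t \<partial>lborel)"
proof -
  interpret P: pair_sigma_finite lborel M
    by standard
  \<comment> \<open>The indicator of a set that varies with \<open>y\<close> becomes a conditional,
    which is visibly measurable jointly in \<open>t\<close> and \<open>y\<close>.\<close>
  have "(\<integral>\<^sup>+y. (\<integral>\<^sup>+t. h t * indicator {0..<y} t \<partial>lborel) \<partial>M)
    = (\<integral>\<^sup>+y. (\<integral>\<^sup>+t. h t * (if 0 \<le> t \<and> t < y then 1 else 0) \<partial>lborel) \<partial>M)"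
    by (intro nn_integral_cong) (auto simp: indicator_def)
  also have "\<dots> = (\<integral>\<^sup>+t. (\<integral>\<^sup>+y. h t * (if 0 \<le> t \<and> t < y then 1 else 0) \<partial>M) \<partial>lborel)"
    by (rule P.Fubini') measurable
  also have "\<dots> = (\<integral>\<^sup>+t. h t * ennreal (tail M t) * indicator {0..} t \<partial>lborel)"
  proof (intro nn_integral_cong)
    fix t
    have "(\<integral>\<^sup>+y. h t * (if 0 \<le> t \<and> t < y then 1 else 0) \<partial>M)
      = (\<integral>\<^sup>+y. (h t * indicator {0..} t) * indicator {t<..} y \<partial>M)"
      by (intro nn_integral_cong) (auto simp: indicator_def)
    also have "\<dots> = h t * indicator {0..} t * emeasure M {t<..}"
      by (rule nn_integral_cmult_indicator) simp
    finally show "(\<integral>\<^sup>+y. h t * (if 0 \<le> t \<and> t < y then 1 else 0) \<partial>M)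
      = h t * ennreal (tail M t) * indicator {0..} t"
      by (simp add: tail_eq_prob emeasure_eq_measure mult_ac)
  qed
  finally show ?thesis .
qed

lemma dists_real_distribution: "F \<in> dists \<Longrightarrow> real_distribution F"
  by (simp add: dists_def)

lemma dists_tail_pos: "F \<in> dists \<Longrightarrow> tail F x > 0"
  by (simp add: dists_def)

lemma dists_AE_nonneg:
  assumes "F \<in> dists" shows "AE y in F. 0 \<le> y"
proof -
  interpret real_distribution F using assms by (rule dists_real_distribution)
  have "prob {..<0} = 0" using assms by (simp add: dists_def)
  then have "{..<0} \<in> null_sets F"
    by (simp add: null_sets_def emeasure_eq_measure)
  then show ?thesis by (rule AE_I') auto
qed

lemma nn_integral_mean_tail:
  assumes "F \<in> dists"
  shows "(\<integral>\<^sup>+y. ennreal y \<partial>F) = (\<integral>\<^sup>+t\<in>{0..}. ennreal (tail F t) \<partial>lborel)"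
proof -
  interpret real_distribution F using assms by (rule dists_real_distribution)
  have "ennreal y = (\<integral>\<^sup>+t. 1 * indicator {0..<y} t \<partial>lborel)" for y :: real
    by (cases "0 \<le> y") (simp_all add: ennreal_neg)
  then show ?thesis using nn_integral_layer_cake[of "\<lambda>_. 1"] by simp
qed

lemma
  assumes "F \<in> dists" "finite_mean F"
  shows nn_integral_tail_finite: "(\<integral>\<^sup>+t\<in>{0..}. ennreal (tail F t) \<partial>lborel) = ennreal (mean F)"
    and set_integrable_tail: "set_integrable lborel {0..} (tail F)"
    and set_integral_tail: "(LINT t:{0..}|lborel. tail F t) = mean F"
    and mean_pos: "mean F > 0"
proof -
  interpret real_distribution F using assms(1) by (rule dists_real_distribution)
  note nonneg = dists_AE_nonneg[OF assms(1)]
  have int: "integrable F (\<lambda>y. y)" using assms(2) by (simp add: finite_mean_def)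
  show *: "(\<integral>\<^sup>+t\<in>{0..}. ennreal (tail F t) \<partial>lborel) = ennreal (mean F)"
    using nn_integral_eq_integral[OF int nonneg] nn_integral_mean_tail[OF assms(1)]
    by (simp add: mean_def)
  have m0: "mean F \<ge> 0"
    unfolding mean_def by (rule integral_nonneg_AE[OF nonneg])
  have **: "(\<integral>\<^sup>+t. ennreal (indicator {0..} t * tail F t) \<partial>lborel) = ennreal (mean F)"
    unfolding *[symmetric] by (intro nn_integral_cong) (auto simp: indicator_def)
  have has: "integrable lborel (\<lambda>t. indicator {0..} t * tail F t) \<and>
      (\<integral>t. indicator {0..} t * tail F t \<partial>lborel) = mean F"
    using ** m0 by (subst nn_integral_eq_integrable[symmetric]) (auto simp: tail_bounds)
  then show "set_integrable lborel {0..} (tail F)" "(LINT t:{0..}|lborel. tail F t) = mean F"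
    by (simp_all add: set_integrable_def set_lebesgue_integral_def)
  \<comment> \<open>A zero mean would put all mass at \<open>0\<close>, contradicting the unbounded
    support.\<close>
  have "mean F \<noteq> 0"
  proof
    assume "mean F = 0"
    then have "AE y in F. y = 0"
      using integral_nonneg_eq_0_iff_AE[OF int nonneg] by (simp add: mean_def)
    then have "AE y in F. y \<notin> {0<..}" by eventually_elim simp
    then have "emeasure F {0<..} = 0"
      by (subst (asm) AE_iff_measurable[of "{0<..}"]) auto
    then have "prob {0<..} = 0" by (simp add: measure_def)
    then show False using dists_tail_pos[OF assms(1), of 0] by (simp add: tail_eq_prob)
  qed
  then show "mean F > 0" using m0 by simp
qed

lemma exp_moment_eq:
  assumes "F \<in> dists" shows "exp_moment F l = (\<integral>\<^sup>+y. ennreal (exp (l * y)) \<partial>F)"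
  unfolding exp_moment_def
  using dists_AE_nonneg[OF assms] by (intro nn_integral_cong_AE) (auto elim!: eventually_mono)

text \<open>Markov's inequality for \<open>exp (l * y)\<close>.\<close>

lemma exp_moment_tail_bound:
  assumes "F \<in> dists" "l > 0" "exp_moment F l < \<infinity>"
  obtains M where "M > 0" "\<And>x. tail F x \<le> M * exp (- l * x)"
proof -
  interpret real_distribution F using assms(1) by (rule dists_real_distribution)
  obtain M where M: "exp_moment F l = ennreal M" "M \<ge> 0"
    using assms(3) by (cases "exp_moment F l") auto
  \<comment> \<open>The moment \<open>M\<close> is only known to be nonnegative; adding
    \<open>1\<close> makes the constant strictly positive.\<close>
  have "tail F x \<le> (M + 1) * exp (- l * x)" for x
  proof -
    have "ennreal (tail F x * exp (l * x)) = (\<integral>\<^sup>+y. ennreal (exp (l * x)) * indicator {x<..} y \<partial>F)"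
      by (subst nn_integral_cmult_indicator)
        (simp_all add: tail_eq_prob emeasure_eq_measure ennreal_mult' mult_ac)
    also have "\<dots> \<le> (\<integral>\<^sup>+y. ennreal (exp (l * y)) \<partial>F)"
      using assms(2) by (intro nn_integral_mono) (auto simp: indicator_def)
    finally have "tail F x * exp (l * x) \<le> M"
      using M by (simp add: exp_moment_eq[OF assms(1), symmetric])
    then have "tail F x * exp (l * x) * exp (- l * x) \<le> (M + 1) * exp (- l * x)"
      by (intro mult_right_mono) auto
    then show ?thesis by (simp add: mult.assoc flip: exp_add)
  qed
  with M(2) that[of "M + 1"] show ?thesis by simp
qed

section \<open>Dominated variation and heavy tails\<close>

lemma class_D_dists: "F \<in> class_D \<Longrightarrow> F \<in> dists"
  by (simp add: class_D_def)

lemma class_D_bound: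
  assumes "F \<in> class_D" "0 < t" "t < 1"
  obtains C where "C > 1" "\<forall>\<^sub>F x in at_top. tail F (t * x) \<le> C * tail F x"
proof -
  have "(\<lambda>x. tail F (t * x)) \<in> O[at_top](tail F)"
    using assms by (simp add: class_D_def)
  then obtain C where C: "C > 0" "\<forall>\<^sub>F x in at_top. norm (tail F (t * x)) \<le> C * norm (tail F x)"
    by (elim landau_o.bigE) auto
  have pos: "0 \<le> tail F x" for x
    by (rule less_imp_le[OF dists_tail_pos[OF class_D_dists[OF assms(1)]]])
  \<comment> \<open>The summand \<open>1\<close> pushes the constant above \<open>1\<close>, so that
    its powers grow.\<close>
  have "\<forall>\<^sub>F x in at_top. tail F (t * x) \<le> (C + 1) * tail F x"
    using C(2) by eventually_elim (simp add: pos distrib_right add_increasing2)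
  with C(1) that[of "C + 1"] show ?thesis by simp
qed

text \<open>Doubling the argument \<open>k\<close> times costs at most a factor
  \<open>C ^ k\<close>, whereas an exponential bound at \<open>2 ^ k * a\<close> is doubly
  exponentially small in \<open>k\<close>; together they would force
  \<open>tail F a \<le> 0\<close>. This gives heavy-tailedness of \<open>F\<close> and later
  excludes \<beta> > \<gamma>.\<close>

lemma class_D_no_exp_bound:
  assumes "F \<in> class_D" "l > 0"
  shows "\<not> (\<forall>x. tail F x \<le> M * exp (- l * x))"
proof
  assume bd: "\<forall>x. tail F x \<le> M * exp (- l * x)"
  note pos = dists_tail_pos[OF class_D_dists[OF assms(1)]]
  obtain C where C: "C > 1" "\<forall>\<^sub>F x in at_top. tail F (1/2 * x) \<le> C * tail F x"
    using class_D_bound[OF assms(1), of "1/2"] by auto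
  then obtain x0 where x0: "\<And>x. x \<ge> x0 \<Longrightarrow> tail F (1/2 * x) \<le> C * tail F x"
    by (auto simp: eventually_at_top_linorder)
  \<comment> \<open>Positivity of \<open>a\<close> makes the points \<open>2 ^ k * a\<close>
    increase to infinity, and \<open>a \<ge> x0\<close> keeps them where the halving bound
    holds.\<close>
  define a where "a = max 1 x0"
  have a: "a \<ge> 1" "a \<ge> x0" by (auto simp: a_def)
  have step: "tail F a \<le> C ^ k * tail F (2 ^ k * a)" for k
  proof (induction k)
    case (Suc k)
    have "1 * a \<le> 2 ^ Suc k * a" using a by (intro mult_right_mono one_le_power) auto
    then have "x0 \<le> 2 ^ Suc k * a" using a by linarith
    from x0[OF this] have "tail F (2 ^ k * a) \<le> C * tail F (2 ^ Suc k * a)" by simp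
    then have "C ^ k * tail F (2 ^ k * a) \<le> C ^ k * (C * tail F (2 ^ Suc k * a))"
      using C by (intro mult_left_mono) auto
    with Suc show ?case by (simp add: mult_ac)
  qed simp
  have le: "tail F a \<le> C ^ k * (M * exp (- l * (2 ^ k * a)))" for k
  proof -
    have "C ^ k * tail F (2 ^ k * a) \<le> C ^ k * (M * exp (- l * (2 ^ k * a)))"
      using C bd by (intro mult_left_mono) auto
    with step[of k] show ?thesis by linarith
  qed
  have "(\<lambda>k::nat. C ^ k * (M * exp (- l * (2 ^ k * a)))) \<longlonglongrightarrow> 0"
  proof -
    define c where "c = l * a"
    have "c > 0" using assms(2) a(1) by (simp add: c_def)
    then have "(\<lambda>k::nat. C ^ k * exp (- (c * 2 ^ k))) \<longlonglongrightarrow> 0"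
      using C(1) by real_asymp
    from tendsto_mult_right_zero[OF this, of M] show ?thesis by (simp add: c_def mult_ac)
  qed
  then have "tail F a \<le> 0"
    by (rule LIMSEQ_le_const) (use le in blast)
  with pos[of a] show False by simp
qed

lemma class_D_subset_class_K:
  assumes "F \<in> class_D" shows "F \<in> class_K"
proof -
  have "exp_moment F l = \<infinity>" if "l > 0" for l
    using exp_moment_tail_bound[OF class_D_dists[OF assms] that]
      class_D_no_exp_bound[OF assms that]
    by (metis infinity_ennreal_def top.not_eq_extremum)
  then show ?thesis using class_D_dists[OF assms] by (simp add: class_K_def)
qed

section \<open>The tilted distribution and its exponential moment\<close>

lemma is_tilt_dists:
  assumes "is_tilt \<gamma> F G" "F \<in> dists"
  shows "G \<in> dists"
proof -
  interpret real_distribution G using assms by (simp add: is_tilt_def)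
  \<comment> \<open>The tail of \<open>G\<close> is \<open>1\<close> only strictly below
    \<open>0\<close>, and an atom at \<open>0\<close> is possible. Hence the open half-line is
    exhausted by closed half-lines with negative endpoints.\<close>
  have "prob {..-(1/real (Suc n))} = 0" for n
    using assms by (simp add: is_tilt_def tail_def cdf_def)
  then have null: "(\<Union>n. {..-(1/real (Suc n))}) \<in> null_sets G"
    by (intro null_sets_UN) (simp add: null_sets_def emeasure_eq_measure)
  have "{..<0} \<subseteq> (\<Union>n. {..-(1/real (Suc n))})"
  proof
    fix x :: real assume "x \<in> {..<0}"
    then obtain n where "1 / real (Suc n) < - x"
      using nat_approx_posE[of "- x"] by auto
    then show "x \<in> (\<Union>n. {..-(1/real (Suc n))})" by (intro UN_I[of n]) auto
  qed
  then have "{..<0} \<in> null_sets G" using null_sets_subset[OF null] by simp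
  then have "prob {..<0} = 0" by (simp add: null_sets_def emeasure_eq_measure)
  moreover have "tail G x > 0" for x
    using assms dists_tail_pos[OF assms(2), of x] by (cases "x < 0") (auto simp: is_tilt_def)
  ultimately show ?thesis using real_distribution_axioms by (simp add: dists_def)
qed

text \<open>By the layer-cake formula the moment is \<open>1\<close> plus the integral of
  \<open>\<gamma> * exp (\<gamma> * t) * tail G t\<close> over \<open>t \<ge> 0\<close>. The tilt
  cancels the exponential, leaving \<open>1 + \<gamma> * mean F\<close>.\<close>

lemma is_tilt_exp_moment_finite:
  assumes "\<gamma> > 0" "is_tilt \<gamma> F G" "F \<in> dists" "finite_mean F"
  shows "exp_moment G \<gamma> < \<infinity>"
proof -
  have G: "G \<in> dists" using assms is_tilt_dists by blast
  interpret real_distribution G using G by (rule dists_real_distribution)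
  have e: "ennreal (exp (\<gamma> * y)) = 1 + (\<integral>\<^sup>+t. ennreal (\<gamma> * exp (\<gamma> * t)) * indicator {0..<y} t \<partial>lborel)"
    if "y \<ge> 0" for y
  proof -
    \<comment> \<open>Adding the null endpoint \<open>y\<close> gives the closed interval required
      by the fundamental theorem of calculus.\<close>
    have "(\<integral>\<^sup>+t. ennreal (\<gamma> * exp (\<gamma> * t)) * indicator {0..<y} t \<partial>lborel)
      = (\<integral>\<^sup>+t. ennreal (\<gamma> * exp (\<gamma> * t)) * indicator {0..y} t \<partial>lborel)"
      using AE_lborel_singleton[of y]
      by (intro nn_integral_cong_AE) (auto elim!: eventually_mono simp: indicator_def)
    also have "\<dots> = ennreal (exp (\<gamma> * y) - exp (\<gamma> * 0))"
      using that assms(1)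
      by (intro nn_integral_FTC_Icc) (auto intro!: derivative_eq_intros)
    finally have "1 + (\<integral>\<^sup>+t. ennreal (\<gamma> * exp (\<gamma> * t)) * indicator {0..<y} t \<partial>lborel)
      = ennreal 1 + ennreal (exp (\<gamma> * y) - 1)" by simp
    also have "\<dots> = ennreal (1 + (exp (\<gamma> * y) - 1))"
      using that assms(1) by (intro ennreal_plus[symmetric]) auto
    finally show ?thesis by simp
  qed
  have "exp_moment G \<gamma> = (\<integral>\<^sup>+y. 1 + (\<integral>\<^sup>+t. ennreal (\<gamma> * exp (\<gamma> * t)) * indicator {0..<y} t \<partial>lborel) \<partial>G)"
    unfolding exp_moment_eq[OF G] using dists_AE_nonneg[OF G]
    by (intro nn_integral_cong_AE) (auto elim!: eventually_mono simp: e)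
  also have "\<dots> = 1 + (\<integral>\<^sup>+y. (\<integral>\<^sup>+t. ennreal (\<gamma> * exp (\<gamma> * t)) * indicator {0..<y} t \<partial>lborel) \<partial>G)"
  proof (subst nn_integral_add)
    have "(\<lambda>y. \<integral>\<^sup>+t. ennreal (\<gamma> * exp (\<gamma> * t)) * (if 0 \<le> t \<and> t < y then 1 else 0) \<partial>lborel)
      \<in> borel_measurable G" by measurable
    also have "(\<lambda>y. \<integral>\<^sup>+t. ennreal (\<gamma> * exp (\<gamma> * t)) * (if 0 \<le> t \<and> t < y then 1 else 0) \<partial>lborel)
      = (\<lambda>y. \<integral>\<^sup>+t. ennreal (\<gamma> * exp (\<gamma> * t)) * indicator {0..<y} t \<partial>lborel)"
      by (intro ext nn_integral_cong) (auto simp: indicator_def)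
    finally show "(\<lambda>y. \<integral>\<^sup>+t. ennreal (\<gamma> * exp (\<gamma> * t)) * indicator {0..<y} t \<partial>lborel)
      \<in> borel_measurable G" .
  qed (simp_all add: emeasure_space_1[simplified])
  also have "\<dots> = 1 + (\<integral>\<^sup>+t. ennreal (\<gamma> * exp (\<gamma> * t)) * ennreal (tail G t) * indicator {0..} t \<partial>lborel)"
    by (subst nn_integral_layer_cake) simp_all
  also have "(\<integral>\<^sup>+t. ennreal (\<gamma> * exp (\<gamma> * t)) * ennreal (tail G t) * indicator {0..} t \<partial>lborel)
    = (\<integral>\<^sup>+t. ennreal \<gamma> * (ennreal (tail F t) * indicator {0..} t) \<partial>lborel)"
  proof (intro nn_integral_cong)
    fix t :: real
    show "ennreal (\<gamma> * exp (\<gamma> * t)) * ennreal (tail G t) * indicator {0..} t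
      = ennreal \<gamma> * (ennreal (tail F t) * indicator {0..} t)"
    proof (cases "t \<ge> 0")
      case True
      then have "\<gamma> * exp (\<gamma> * t) * tail G t = \<gamma> * tail F t"
        using assms(2) by (simp add: is_tilt_def mult_ac flip: exp_add)
      then show ?thesis using assms(1) True
        by (simp add: ennreal_mult'[symmetric] mult.assoc)
    qed simp
  qed
  also have "\<dots> = ennreal \<gamma> * ennreal (mean F)"
  proof -
    interpret F: real_distribution F using assms(3) by (rule dists_real_distribution)
    show ?thesis
      by (subst nn_integral_cmult) (simp_all add: nn_integral_tail_finite[OF assms(3,4)])
  qed
  finally show ?thesis by (simp add: ennreal_mult_less_top)
qed

lemma is_tilt_tail:
  "is_tilt \<gamma> F G \<Longrightarrow> x \<ge> 0 \<Longrightarrow> tail G x = tail F x * exp (- \<gamma> * x)"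
  by (simp add: is_tilt_def)

section \<open>The single big jump for the tilted distribution\<close>

text \<open>By independence the expectation factorises into powers of the exponential moment. The
  integrand later serves as the dominating function.\<close>

lemma integrable_exp_sum_PiM:
  assumes G: "G \<in> dists" and fin: "exp_moment G \<gamma> < \<infinity>" and J: "finite J"
  shows "integrable (PiM J (\<lambda>_. G)) (\<lambda>X. exp (\<gamma> * (\<Sum>j\<in>J. X j)))"
proof (rule integrableI_nonneg)
  interpret G: real_distribution G using G by (rule dists_real_distribution)
  interpret product_sigma_finite "\<lambda>_. G" by standard
  show "(\<lambda>X. exp (\<gamma> * (\<Sum>j\<in>J. X j))) \<in> borel_measurable (PiM J (\<lambda>_. G))"
    by measurable
  have "(\<integral>\<^sup>+X. ennreal (exp (\<gamma> * (\<Sum>j\<in>J. X j))) \<partial>PiM J (\<lambda>_. G))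
    = (\<integral>\<^sup>+X. (\<Prod>j\<in>J. ennreal (exp (\<gamma> * X j))) \<partial>PiM J (\<lambda>_. G))"
    using J by (simp add: sum_distrib_left exp_sum prod_ennreal)
  also have "\<dots> = (\<Prod>j\<in>J. exp_moment G \<gamma>)"
    unfolding exp_moment_eq[OF G]
    by (rule product_nn_integral_prod[OF J]) measurable
  also have "\<dots> < \<infinity>"
    using fin by (simp add: power_less_top_ennreal)
  finally show "(\<integral>\<^sup>+X. ennreal (exp (\<gamma> * (\<Sum>j\<in>J. X j))) \<partial>PiM J (\<lambda>_. G)) < \<infinity>" .
qed simp

text \<open>This is \<open>E[exp (\<gamma> * T); T > K]\<close> for the sum \<open>T\<close> of
  independent copies indexed by \<open>J\<close>: the mass above \<open>K\<close> of the law of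
  \<open>T\<close> reweighted by \<open>exp (\<gamma> * T)\<close>, without normalisation.\<close>

definition tilted_excess :: "real measure \<Rightarrow> real \<Rightarrow> 'i set \<Rightarrow> real \<Rightarrow> real" where
  "tilted_excess G \<gamma> J K =
     (\<integral>X. indicator {K<..} (\<Sum>j\<in>J. X j) * exp (\<gamma> * (\<Sum>j\<in>J. X j)) \<partial>PiM J (\<lambda>_. G))"

text \<open>Dominated convergence: at each fixed \<open>X\<close> the indicator vanishes once
  \<open>K\<close> reaches the sum.\<close>

lemma tilted_excess_tendsto_0:
  assumes G: "G \<in> dists" and fin: "exp_moment G \<gamma> < \<infinity>" and J: "finite J"
  shows "(tilted_excess G \<gamma> J \<longlongrightarrow> 0) at_top"
proof -
  interpret G: real_distribution G using G by (rule dists_real_distribution)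
  let ?M = "PiM J (\<lambda>_. G)"
  have "((\<lambda>K. \<integral>X. indicator {K<..} (\<Sum>j\<in>J. X j) * exp (\<gamma> * (\<Sum>j\<in>J. X j)) \<partial>?M)
      \<longlongrightarrow> (\<integral>X. 0 \<partial>?M)) at_top"
  proof (rule integral_dominated_convergence_at_top[OF _ _ integrable_exp_sum_PiM[OF assms]])
    show "\<forall>\<^sub>F K in at_top. AE X in ?M. norm (indicator {K<..} (\<Sum>j\<in>J. X j) * exp (\<gamma> * (\<Sum>j\<in>J. X j)))
        \<le> exp (\<gamma> * (\<Sum>j\<in>J. X j))"
      by (auto simp: indicator_def)
    show "AE X in ?M. ((\<lambda>K. indicator {K<..} (\<Sum>j\<in>J. X j) * exp (\<gamma> * (\<Sum>j\<in>J. X j))) \<longlongrightarrow> 0) at_top"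
    proof (intro AE_I2 tendsto_eventually)
      fix X :: "'a \<Rightarrow> real"
      show "\<forall>\<^sub>F K in at_top. indicator {K<..} (\<Sum>j\<in>J. X j) * exp (\<gamma> * (\<Sum>j\<in>J. X j)) = 0"
        using eventually_ge_at_top[of "\<Sum>j\<in>J. X j"] by eventually_elim simp
    qed
  qed measurable
  then show ?thesis by (simp add: tilted_excess_def[abs_def])
qed

text \<open>Given the sum \<open>T\<close> over \<open>J\<close>, the event forces
  \<open>X i > m\<close> with \<open>m = max z (x - T)\<close>. The two lower bounds on
  \<open>m\<close> serve different factors of \<open>tail G m\<close>: \<open>m \<ge> z\<close>
  gives \<open>tail F m \<le> C * tail F x\<close>, and \<open>m \<ge> x - T\<close> gives
  \<open>exp (- \<gamma> * m) \<le> exp (- \<gamma> * x) * exp (\<gamma> * T)\<close>.\<close>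

lemma tilted_excess_bound:
  assumes tilt: "is_tilt \<gamma> F G" and F: "F \<in> dists" and \<gamma>: "\<gamma> > 0"
    and fin: "exp_moment G \<gamma> < \<infinity>" and J: "finite J" "i \<notin> J"
    and x: "0 \<le> z" "z \<le> x" and C: "C \<ge> 0" "tail F z \<le> C * tail F x"
  shows "\<P>(X in PiM (insert i J) (\<lambda>_. G). z < X i \<and> x < (\<Sum>j\<in>insert i J. X j) \<and> K < (\<Sum>j\<in>J. X j))
    \<le> C * tail G x * tilted_excess G \<gamma> J K" (is "?lhs \<le> _")
proof -
  have G: "G \<in> dists" using is_tilt_dists[OF tilt F] .
  interpret F: real_distribution F using F by (rule dists_real_distribution)
  interpret G: real_distribution G using G by (rule dists_real_distribution)
  interpret product_sigma_finite "\<lambda>_. G" by standard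
  interpret P: prob_space "PiM (insert i J) (\<lambda>_. G)"
    by (rule prob_space_PiM) (rule G.prob_space_axioms)
  let ?T = "\<lambda>X. \<Sum>j\<in>J. X j"
  let ?h = "\<lambda>X. indicator {K<..} (?T X) * exp (\<gamma> * ?T X)"
  let ?E = "{X \<in> space (PiM (insert i J) (\<lambda>_. G)). z < X i \<and> x < (\<Sum>j\<in>insert i J. X j) \<and> K < ?T X}"
  have inner: "(\<integral>\<^sup>+y. indicator ?E (X(i := y)) \<partial>G) \<le> ennreal (C * tail G x) * ennreal (?h X)"
    if X: "X \<in> space (PiM J (\<lambda>_. G))" for X
  proof -
    define m where "m = max z (x - ?T X)"
    have [simp]: "(\<Sum>j\<in>J. (X(i := y)) j) = ?T X" for y
      using J by (intro sum.cong) auto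
    have "(\<integral>\<^sup>+y. indicator ?E (X(i := y)) \<partial>G)
        \<le> (\<integral>\<^sup>+y. indicator {K<..} (?T X) * indicator {m<..} y \<partial>G)"
    proof (intro nn_integral_mono)
      fix y
      have "X(i := y) \<in> ?E \<Longrightarrow> K < ?T X \<and> m < y"
        using J by (auto simp: m_def simp del: fun_upd_apply) (simp_all add: algebra_simps)
      then show "indicator ?E (X(i := y)) \<le> (indicator {K<..} (?T X) * indicator {m<..} y :: ennreal)"
        by (auto simp: indicator_def)
    qed
    also have "\<dots> = indicator {K<..} (?T X) * ennreal (tail G m)"
      by (subst nn_integral_cmult_indicator) (auto simp: G.tail_eq_prob G.emeasure_eq_measure)
    also have "\<dots> \<le> indicator {K<..} (?T X) * ennreal (C * tail G x * exp (\<gamma> * ?T X))"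
    proof (intro mult_left_mono ennreal_leI)
      have m: "m \<ge> z" "m \<ge> x - ?T X" by (auto simp: m_def)
      have "tail G m = tail F m * exp (- \<gamma> * m)" using m x by (intro is_tilt_tail[OF tilt]) auto
      also have "\<dots> \<le> (C * tail F x) * exp (- \<gamma> * (x - ?T X))"
        using F.tail_antimono[OF m(1)] C m(2) \<gamma> F.tail_bounds by (intro mult_mono) auto
      also have "\<dots> = C * tail G x * exp (\<gamma> * ?T X)"
        using x by (simp add: is_tilt_tail[OF tilt] mult.assoc algebra_simps flip: exp_add)
      finally show "tail G m \<le> C * tail G x * exp (\<gamma> * ?T X)" .
    qed simp
    also have "\<dots> = ennreal (C * tail G x) * ennreal (?h X)"
      using C G.tail_bounds by (auto simp: ennreal_mult'[symmetric] indicator_def)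
    finally show ?thesis .
  qed
  have E: "?E \<in> sets (PiM (insert i J) (\<lambda>_. G))" by measurable
  have int: "integrable (PiM J (\<lambda>_. G)) ?h"
    by (rule Bochner_Integration.integrable_bound[OF integrable_exp_sum_PiM[OF G fin J(1)]])
      (auto simp: indicator_def)
  have "ennreal ?lhs = emeasure (PiM (insert i J) (\<lambda>_. G)) ?E"
    by (simp add: P.emeasure_eq_measure)
  also have "\<dots> = (\<integral>\<^sup>+X. indicator ?E X \<partial>PiM (insert i J) (\<lambda>_. G))"
    using E by (rule nn_integral_indicator[symmetric])
  \<comment> \<open>Fubini splits off coordinate \<open>i\<close>, which amounts to conditioning on
    the coordinates in \<open>J\<close>.\<close>
  also have "\<dots> = (\<integral>\<^sup>+X. (\<integral>\<^sup>+y. indicator ?E (X(i := y)) \<partial>G) \<partial>PiM J (\<lambda>_. G))"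
    by (rule product_nn_integral_insert[OF J]) (intro borel_measurable_indicator E)
  also have "\<dots> \<le> (\<integral>\<^sup>+X. ennreal (C * tail G x) * ennreal (?h X) \<partial>PiM J (\<lambda>_. G))"
    by (intro nn_integral_mono inner)
  also have "\<dots> = ennreal (C * tail G x) * (\<integral>\<^sup>+X. ennreal (?h X) \<partial>PiM J (\<lambda>_. G))"
    by (rule nn_integral_cmult) measurable
  also have "(\<integral>\<^sup>+X. ennreal (?h X) \<partial>PiM J (\<lambda>_. G)) = ennreal (tilted_excess G \<gamma> J K)"
    unfolding tilted_excess_def by (rule nn_integral_eq_integral[OF int]) auto
  also have "ennreal (C * tail G x) * ennreal (tilted_excess G \<gamma> J K)
      = ennreal (C * tail G x * tilted_excess G \<gamma> J K)"
    using C G.tail_bounds by (intro ennreal_mult'[symmetric]) auto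
  finally show ?thesis
    using C G.tail_bounds by (subst (asm) ennreal_le_iff)
      (auto simp: tilted_excess_def intro!: mult_nonneg_nonneg integral_nonneg)
qed

text \<open>The sum exceeds \<open>x\<close> on the box where coordinate \<open>i\<close> exceeds
  \<open>x\<close> and the others are nonnegative. The latter constraints have probability one, so
  the box has probability \<open>tail G x\<close>.\<close>

lemma tail_le_prob_sum:
  assumes G: "G \<in> dists" and I: "finite I" "i \<in> I"
  shows "tail G x \<le> \<P>(X in PiM I (\<lambda>_. G). (\<Sum>j\<in>I. X j) > x)"
proof -
  interpret G: real_distribution G using G by (rule dists_real_distribution)
  interpret finite_product_prob_space "\<lambda>_. G" I by standard (rule I)
  define A where "A j = (if j = i then {x<..} else {0..})" for j
  have "G.prob {0..} = 1"
    using dists_AE_nonneg[OF G] by (intro G.prob_eq_1[THEN iffD2]) auto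
  then have "tail G x = (\<Prod>j\<in>I. G.prob (A j))"
    using I by (subst prod.remove[OF I]) (auto simp: A_def G.tail_eq_prob intro!: prod.neutral[symmetric])
  also have "\<dots> = prob (Pi\<^sub>E I A)"
    by (rule prob_times[symmetric]) (auto simp: A_def)
  also have "\<dots> \<le> \<P>(X in PiM I (\<lambda>_. G). (\<Sum>j\<in>I. X j) > x)"
  proof (rule finite_measure_mono)
    show "Pi\<^sub>E I A \<subseteq> {X \<in> space (PiM I (\<lambda>_. G)). (\<Sum>j\<in>I. X j) > x}"
    proof
      fix X assume X: "X \<in> Pi\<^sub>E I A"
      then have "X i > x" "\<And>j. j \<in> I - {i} \<Longrightarrow> X j \<ge> 0"
        using I by (auto simp: A_def PiE_def Pi_def split: if_splits)
      then have "(\<Sum>j\<in>I. X j) > x"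
        using sum_nonneg[of "I - {i}" X] by (subst sum.remove[OF I]) auto
      then show "X \<in> {X \<in> space (PiM I (\<lambda>_. G)). (\<Sum>j\<in>I. X j) > x}"
        using X by (auto simp: space_PiM PiE_def)
    qed
  qed measurable
  finally show ?thesis .
qed

text \<open>The event \<open>B\<close> that the sum exceeds \<open>x\<close> is covered by the
  big-jump event \<open>A\<close> and the events \<open>E i\<close>. The bounds on the
  \<open>E i\<close> carry a factor \<open>tail G x\<close>, which is at most the probability of
  \<open>B\<close>; dividing by that probability gives the claim.\<close>

lemma big_jump_prob_ge:
  assumes tilt: "is_tilt \<gamma> F G" and F: "F \<in> dists" and \<gamma>: "\<gamma> > 0"
    and fin: "exp_moment G \<gamma> < \<infinity>" and n: "n \<ge> 1" and x: "x > 0"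
    and C: "C \<ge> 0" "tail F (x / n) \<le> C * tail F x"
  shows "1 - C * (\<Sum>i\<in>{1..n}. tilted_excess G \<gamma> ({1..n} - {i}) K) \<le> big_jump_prob G n K x"
proof -
  have G: "G \<in> dists" using is_tilt_dists[OF tilt F] .
  interpret G: real_distribution G using G by (rule dists_real_distribution)
  let ?P = "PiM {1..n} (\<lambda>_. G)"
  interpret P: prob_space ?P by (rule prob_space_PiM) (rule G.prob_space_axioms)
  let ?S = "\<lambda>X. \<Sum>i\<in>{1..n}. X i"
  define E where "E i = {X \<in> space ?P. x / n < X i \<and> x < ?S X \<and> K < (\<Sum>j\<in>{1..n} - {i}. X j)}" for i
  define A where "A = {X \<in> space ?P. (MAX i\<in>{1..n}. X i) > x - K \<and> ?S X > x}"
  define B where "B = {X \<in> space ?P. ?S X > x}"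
  define D where "D = (\<Sum>i\<in>{1..n}. tilted_excess G \<gamma> ({1..n} - {i}) K)"
  \<comment> \<open>The existential form yields measurability and the bounds on all coordinates off
    \<open>A\<close>.\<close>
  have A_eq: "A = {X \<in> space ?P. (\<exists>i\<in>{1..n}. X i > x - K) \<and> ?S X > x}"
    using n by (auto simp: A_def Max_gr_iff)
  have A_sets: "A \<in> sets ?P" unfolding A_eq by measurable
  have E_sets: "E i \<in> sets ?P" if "i \<in> {1..n}" for i
    using that unfolding E_def by measurable
  have E_le: "P.prob (E i) \<le> C * tail G x * tilted_excess G \<gamma> ({1..n} - {i}) K" if "i \<in> {1..n}" for i
  proof -
    have ins: "insert i ({1..n} - {i}) = {1..n}" using that by auto
    have "x / n \<le> x" using n x by (simp add: field_simps)
    then show ?thesis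
      using tilted_excess_bound[OF tilt F \<gamma> fin, of "{1..n} - {i}" i "x / n" x C K] x C
      unfolding ins E_def by simp
  qed
  have "B \<subseteq> A \<union> (\<Union>i\<in>{1..n}. E i)"
  proof
    fix X assume X: "X \<in> B"
    show "X \<in> A \<union> (\<Union>i\<in>{1..n}. E i)"
    proof (cases "X \<in> A")
      case False
      then have le: "X i \<le> x - K" if "i \<in> {1..n}" for i
        using X that by (force simp: A_eq B_def)
      \<comment> \<open>Some summand exceeds the average. Off \<open>A\<close> it is at most
        \<open>x - K\<close>, so the remaining ones sum to more than \<open>K\<close>.\<close>
      have "\<exists>i\<in>{1..n}. x / n < X i"
      proof (rule ccontr)
        assume "\<not> ?thesis"
        then have "?S X \<le> of_nat (card {1..n}) * (x / n)"
          by (intro sum_bounded_above) (auto simp: not_less)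
        then show False using X n by (simp add: B_def)
      qed
      then obtain i where i: "i \<in> {1..n}" "x / n < X i" by blast
      have "?S X = X i + (\<Sum>j\<in>{1..n} - {i}. X j)"
        using i by (intro sum.remove) auto
      then have "X \<in> E i" using X i le[OF i(1)] by (auto simp: E_def B_def)
      then show ?thesis using i by blast
    qed auto
  qed
  then have "P.prob B \<le> P.prob (A \<union> (\<Union>i\<in>{1..n}. E i))"
    by (intro P.finite_measure_mono sets.Un sets.finite_UN A_sets E_sets) simp_all
  also have "\<dots> \<le> P.prob A + P.prob (\<Union>i\<in>{1..n}. E i)"
    by (intro measure_Un_le sets.finite_UN A_sets E_sets) simp_all
  also have "P.prob (\<Union>i\<in>{1..n}. E i) \<le> (\<Sum>i\<in>{1..n}. P.prob (E i))"
    by (intro measure_UNION_le E_sets) auto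
  also have "\<dots> \<le> (\<Sum>i\<in>{1..n}. C * tail G x * tilted_excess G \<gamma> ({1..n} - {i}) K)"
    by (intro sum_mono E_le)
  also have "\<dots> = C * D * tail G x"
    by (simp add: D_def sum_distrib_left sum_distrib_right mult_ac)
  also have "C * D * tail G x \<le> C * D * P.prob B"
  proof (rule mult_left_mono)
    show "tail G x \<le> P.prob B"
      unfolding B_def by (rule tail_le_prob_sum[OF G, of _ 1]) (use n in auto)
    show "0 \<le> C * D"
      using C unfolding D_def
      by (auto simp: tilted_excess_def intro!: mult_nonneg_nonneg sum_nonneg integral_nonneg)
  qed
  finally have le: "(1 - C * D) * P.prob B \<le> P.prob A" by (simp add: algebra_simps)
  have "0 < tail G x" by (rule dists_tail_pos[OF G])
  also have "tail G x \<le> P.prob B"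
    unfolding B_def by (rule tail_le_prob_sum[OF G, of _ 1]) (use n in auto)
  finally have "1 - C * D \<le> P.prob A / P.prob B"
    using le by (simp add: pos_le_divide_eq)
  then show ?thesis
    by (simp add: big_jump_prob_def cond_prob_def A_def B_def D_def)
qed

text \<open>The constant \<open>C\<close> depends on \<open>n\<close> but not on \<open>K\<close>.
  Hence the lower bound \<open>1 - C * D K\<close>, valid for all large \<open>x\<close>, passes to
  the \<open>Liminf\<close> and then tends to \<open>1\<close> as \<open>K\<close> grows.\<close>

lemma is_tilt_class_J:
  assumes \<gamma>: "\<gamma> > 0" and tilt: "is_tilt \<gamma> F G" and FD: "F \<in> class_D" and fm: "finite_mean F"
  shows "G \<in> class_J"
proof -
  have F: "F \<in> dists" using FD by (rule class_D_dists)
  have G: "G \<in> dists" using is_tilt_dists[OF tilt F] .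
  have fin: "exp_moment G \<gamma> < \<infinity>" by (rule is_tilt_exp_moment_finite[OF \<gamma> tilt F fm])
  have "((\<lambda>K. Liminf at_top (\<lambda>x. ereal (big_jump_prob G n K x))) \<longlongrightarrow> 1) at_top"
    if n: "n \<ge> 2" for n
  proof -
    obtain C where C: "C > 1" "\<forall>\<^sub>F x in at_top. tail F (1 / n * x) \<le> C * tail F x"
      using class_D_bound[OF FD, of "1 / n"] n by auto
    define D where "D K = (\<Sum>i\<in>{1..n}. tilted_excess G \<gamma> ({1..n} - {i}) K)" for K
    have "(D \<longlongrightarrow> (\<Sum>i\<in>{1..n}. 0)) at_top"
      unfolding D_def by (intro tendsto_sum tilted_excess_tendsto_0 G fin) auto
    then have "((\<lambda>K. ereal (1 - C * D K)) \<longlongrightarrow> ereal (1 - C * (\<Sum>i\<in>{1..n}. 0))) at_top"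
      by (intro tendsto_intros)
    then have lim: "((\<lambda>K. ereal (1 - C * D K)) \<longlongrightarrow> 1) at_top" by (simp add: one_ereal_def)
    show ?thesis
    proof (rule tendsto_sandwich[OF _ _ lim tendsto_const])
      have "ereal (1 - C * D K) \<le> Liminf at_top (\<lambda>x. ereal (big_jump_prob G n K x))" for K
      proof (rule Liminf_bounded)
        show "\<forall>\<^sub>F x in at_top. ereal (1 - C * D K) \<le> ereal (big_jump_prob G n K x)"
          using C(2) eventually_gt_at_top[of 0]
        proof eventually_elim
          case (elim x)
          show ?case unfolding D_def
            using big_jump_prob_ge[OF tilt F \<gamma> fin, of n x C K] n elim C(1) by simp
        qed
      qed
      then show "\<forall>\<^sub>F K in at_top. ereal (1 - C * D K) \<le> Liminf at_top (\<lambda>x. ereal (big_jump_prob G n K x))"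
        by simp
      have "big_jump_prob G n K x \<le> 1" for K x
      proof -
        interpret G: real_distribution G using G by (rule dists_real_distribution)
        interpret P: prob_space "PiM {1..n} (\<lambda>_. G)" by (rule prob_space_PiM) (rule G.prob_space_axioms)
        have "\<P>(X in PiM {1..n} (\<lambda>_. G). (MAX i\<in>{1..n}. X i) > x - K \<and> (\<Sum>i\<in>{1..n}. X i) > x)
            \<le> \<P>(X in PiM {1..n} (\<lambda>_. G). (\<Sum>i\<in>{1..n}. X i) > x)"
          by (rule P.finite_measure_mono) (auto, measurable)
        then show ?thesis
          unfolding big_jump_prob_def cond_prob_def by (intro divide_le_eq_1[THEN iffD2]) (metis linorder_neqE_linordered_idom measure_nonneg not_less)
      qed
      then have "Liminf at_top (\<lambda>x. ereal (big_jump_prob G n K x)) \<le> Liminf at_top (\<lambda>x::real. 1)" for K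
        by (intro Liminf_mono always_eventually) (simp add: one_ereal_def)
      then show "\<forall>\<^sub>F K in at_top. Liminf at_top (\<lambda>x. ereal (big_jump_prob G n K x)) \<le> 1"
        by (simp add: Liminf_const)
    qed
  qed
  with G show ?thesis by (simp add: class_J_def)
qed

section \<open>Long tails, dominated variation and strong subexponentiality\<close>

text \<open>By symmetry the convolution integral is twice its part over \<open>[0, x/2]\<close>.
  There the quotient \<open>tail F (x - y) / tail F x\<close> is bounded by dominated variation and
  tends to \<open>1\<close> by long-tailedness, so the integrable bound \<open>C * tail F y\<close>
  gives the limit \<open>2 * mean F\<close>.\<close>

lemma long_tailed_class_D_subset_class_S_star:
  assumes FD: "F \<in> class_D" and fm: "finite_mean F"
    and long: "\<And>t. ((\<lambda>x. tail F (x + t) / tail F x) \<longlongrightarrow> 1) at_top"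
  shows "F \<in> class_S_star"
proof -
  have F: "F \<in> dists" using FD by (rule class_D_dists)
  interpret real_distribution F using F by (rule dists_real_distribution)
  note pos = dists_tail_pos[OF F]
  define f where "f x y = indicator {0..x/2} y * (tail F (x - y) * tail F y)" for x y :: real
  have int: "integrable lborel (f x)" for x
  proof (rule Bochner_Integration.integrable_bound)
    show "integrable lborel (indicator {0..x/2} :: real \<Rightarrow> real)"
      by (rule integrable_real_indicator) (simp_all add: emeasure_lborel_Icc_eq)
    show "f x \<in> borel_measurable lborel" unfolding f_def by measurable
    show "AE y in lborel. norm (f x y) \<le> norm (indicator {0..x/2} y :: real)"
      by (intro AE_I2) (auto simp: f_def indicator_def tail_bounds abs_mult intro!: mult_le_one)
  qed
  have conv: "(LINT y:{0..x}|lborel. tail F (x - y) * tail F y) = 2 * (\<integral>y. f x y \<partial>lborel)" for x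
  proof -
    \<comment> \<open>The reflection \<open>y \<mapsto> x - y\<close> carries the upper half of the
      interval to the lower half.\<close>
    have "(LINT y:{0..x}|lborel. tail F (x - y) * tail F y) = (\<integral>y. f x y + f x (x - y) \<partial>lborel)"
      unfolding set_lebesgue_integral_def
    proof (rule integral_cong_AE)
      \<comment> \<open>The midpoint \<open>y = x/2\<close> is counted twice on the right.\<close>
      show "AE y in lborel. indicator {0..x} y *\<^sub>R (tail F (x - y) * tail F y) = f x y + f x (x - y)"
        using AE_lborel_singleton[of "x/2"]
        by eventually_elim (auto simp: f_def indicator_def)
    qed (auto simp: f_def)
    also have "\<dots> = (\<integral>y. f x y \<partial>lborel) + (\<integral>y. f x (x - y) \<partial>lborel)"
      using lborel_integrable_real_affine[OF int[of x], of "-1" x]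
      by (intro Bochner_Integration.integral_add int) simp
    also have "(\<integral>y. f x (x - y) \<partial>lborel) = (\<integral>y. f x y \<partial>lborel)"
      using lborel_integral_real_affine[of "-1" "f x" x] by simp
    finally show ?thesis by simp
  qed
  obtain C where C: "C > 1" "\<forall>\<^sub>F x in at_top. tail F (1/2 * x) \<le> C * tail F x"
    using class_D_bound[OF FD, of "1/2"] by auto
  have "((\<lambda>x. \<integral>y. f x y / tail F x \<partial>lborel) \<longlongrightarrow> (\<integral>y. indicator {0..} y * tail F y \<partial>lborel)) at_top"
  proof (rule integral_dominated_convergence_at_top)
    show "integrable lborel (\<lambda>y. C * (indicator {0..} y * tail F y))"
      using set_integrable_tail[OF F fm] by (simp add: set_integrable_def)
    show "\<forall>\<^sub>F x in at_top. AE y in lborel. norm (f x y / tail F x) \<le> C * (indicator {0..} y * tail F y)"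
      using C(2)
    proof eventually_elim
      case (elim x)
      show ?case
      proof (intro AE_I2)
        fix y
        show "norm (f x y / tail F x) \<le> C * (indicator {0..} y * tail F y)"
        proof (cases "y \<in> {0..x/2}")
          case True
          \<comment> \<open>For \<open>y \<le> x/2\<close> the point \<open>x - y\<close> is at
            least \<open>x/2\<close>.\<close>
          then have "tail F (x - y) \<le> C * tail F x"
            using elim tail_antimono[of "1/2 * x" "x - y"] by simp
          then have "tail F (x - y) * tail F y \<le> (C * tail F x) * tail F y"
            by (intro mult_right_mono tail_bounds)
          then show ?thesis using True pos[of x] tail_bounds
            by (simp add: f_def abs_mult pos_divide_le_eq mult_ac)
        next
          case False
          then show ?thesis using C(1) tail_bounds by (simp add: f_def)
        qed
      qed
    qed
    show "AE y in lborel. ((\<lambda>x. f x y / tail F x) \<longlongrightarrow> indicator {0..} y * tail F y) at_top"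
    proof (intro AE_I2)
      fix y :: real
      have "((\<lambda>x. indicator {0..} y * (tail F (x + - y) / tail F x * tail F y))
          \<longlongrightarrow> indicator {0..} y * (1 * tail F y)) at_top"
        by (intro tendsto_intros long)
      moreover have "\<forall>\<^sub>F x in at_top. indicator {0..} y * (tail F (x + - y) / tail F x * tail F y)
          = f x y / tail F x"
        using eventually_ge_at_top[of "2 * y"]
        by eventually_elim (auto simp: f_def indicator_def)
      ultimately show "((\<lambda>x. f x y / tail F x) \<longlongrightarrow> indicator {0..} y * tail F y) at_top"
        by (rule Lim_transform_eventually[THEN tendsto_eq_rhs]) simp
    qed
  qed (auto simp: f_def)
  then have "((\<lambda>x. \<integral>y. f x y / tail F x \<partial>lborel) \<longlongrightarrow> mean F) at_top"
    using set_integral_tail[OF F fm] by (simp add: set_lebesgue_integral_def)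
  then have "((\<lambda>x. ereal (2 * (\<integral>y. f x y / tail F x \<partial>lborel))) \<longlongrightarrow> ereal (2 * mean F)) at_top"
    by (intro tendsto_intros)
  then have "Limsup at_top (\<lambda>x. ereal ((LINT y:{0..x}|lborel. tail F (x - y) * tail F y) / tail F x))
      = ereal (2 * mean F)"
    by (intro lim_imp_Limsup) (simp_all add: conv)
  then show ?thesis
    using class_D_subset_class_K[OF FD] fm mean_pos[OF F fm] by (simp add: class_S_star_def)
qed

section \<open>Excluding convolution equivalence\<close>

text \<open>Undoing the tilt multiplies the quotient of tails of \<open>G\<close> by
  \<open>exp (\<gamma> * t)\<close>, which combines with the limit
  \<open>exp (- \<beta> * t)\<close>.\<close>

lemma is_tilt_class_L_ratio:
  assumes tilt: "is_tilt \<gamma> F G" and F: "F \<in> dists" and L: "G \<in> class_L \<beta>"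
  shows "((\<lambda>x. tail F (x + t) / tail F x) \<longlongrightarrow> exp ((\<gamma> - \<beta>) * t)) at_top"
proof (cases "t = 0")
  case True
  then show ?thesis using dists_tail_pos[OF F] by (simp add: less_imp_neq[symmetric])
next
  case False
  have G: "G \<in> dists" using is_tilt_dists[OF tilt F] .
  have "(\<lambda>x. tail G (x + t)) \<sim>[at_top] (\<lambda>x. exp (- \<beta> * t) * tail G x)"
    using L False by (simp add: class_L_def)
  then have "((\<lambda>x. tail G (x + t) / (exp (- \<beta> * t) * tail G x)) \<longlongrightarrow> 1) at_top"
    by (rule asymp_equivD_strong) (use dists_tail_pos[OF G] in \<open>simp add: less_imp_neq[symmetric]\<close>)
  then have "((\<lambda>x. exp ((\<gamma> - \<beta>) * t) * (tail G (x + t) / (exp (- \<beta> * t) * tail G x)))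
      \<longlongrightarrow> exp ((\<gamma> - \<beta>) * t) * 1) at_top"
    by (intro tendsto_intros)
  moreover have "\<forall>\<^sub>F x in at_top. exp ((\<gamma> - \<beta>) * t) * (tail G (x + t) / (exp (- \<beta> * t) * tail G x))
      = tail F (x + t) / tail F x"
    \<comment> \<open>From here on both \<open>x\<close> and \<open>x + t\<close> are nonnegative,
      so the tilt formula applies to each.\<close>
    using eventually_ge_at_top[of "max 0 (- t)"]
  proof eventually_elim
    case (elim x)
    have "exp ((\<gamma> - \<beta>) * t) * exp (- \<gamma> * (x + t)) = exp (- \<beta> * t) * exp (- \<gamma> * x)"
      by (simp add: algebra_simps flip: exp_add)
    then show ?case
      using elim dists_tail_pos[OF F, of x]
      by (simp add: is_tilt_tail[OF tilt] frac_eq_eq)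
  qed
  ultimately show ?thesis by (rule Lim_transform_eventually[THEN tendsto_eq_rhs]) simp
qed

lemma is_tilt_not_class_S:
  assumes \<gamma>: "\<gamma> > 0" and tilt: "is_tilt \<gamma> F G" and F: "F \<in> class_Df - class_S_star" and \<beta>: "\<beta> > 0"
  shows "G \<notin> class_S \<beta>"
proof
  assume S: "G \<in> class_S \<beta>"
  then have L: "G \<in> class_L \<beta>" and fin: "exp_moment G \<beta> < \<infinity>" by (auto simp: class_S_def)
  have FD: "F \<in> class_D" and fm: "finite_mean F" using F by (auto simp: class_Df_def)
  have Fd: "F \<in> dists" using FD by (rule class_D_dists)
  interpret real_distribution F using Fd by (rule dists_real_distribution)
  note ratio = is_tilt_class_L_ratio[OF tilt Fd L]
  consider "\<beta> < \<gamma>" | "\<beta> = \<gamma>" | "\<beta> > \<gamma>" by linarith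
  then show False
  proof cases
    case 1
    \<comment> \<open>At \<open>t = 1\<close> the quotients are at most \<open>1\<close> by
      monotonicity, while their limit would exceed \<open>1\<close>.\<close>
    have "exp ((\<gamma> - \<beta>) * 1) \<le> 1"
    proof (rule tendsto_upperbound[OF ratio])
      show "\<forall>\<^sub>F x in at_top. tail F (x + 1) / tail F x \<le> 1"
        using dists_tail_pos[OF Fd] by (simp add: tail_antimono)
    qed simp
    with 1 show False by simp
  next
    case 2
    then have "((\<lambda>x. tail F (x + t) / tail F x) \<longlongrightarrow> 1) at_top" for t
      using ratio[of t] by simp
    then have "F \<in> class_S_star" by (rule long_tailed_class_D_subset_class_S_star[OF FD fm])
    with F show False by simp
  next
    case 3
    obtain M where M: "M > 0" "\<And>x. tail G x \<le> M * exp (- \<beta> * x)"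
      using exp_moment_tail_bound[OF is_tilt_dists[OF tilt Fd] \<beta> fin] by blast
    \<comment> \<open>Untilting the exponential bound on \<open>tail G\<close> handles
      \<open>x \<ge> 0\<close>. For negative \<open>x\<close> the exponential is at least
      \<open>1\<close>, so a constant of at least \<open>1\<close> suffices.\<close>
    have "tail F x \<le> max 1 M * exp (- (\<beta> - \<gamma>) * x)" for x
    proof (cases "x \<ge> 0")
      case True
      have "tail F x = tail G x * exp (\<gamma> * x)"
        using True by (simp add: is_tilt_tail[OF tilt] mult.assoc flip: exp_add)
      also have "\<dots> \<le> M * exp (- \<beta> * x) * exp (\<gamma> * x)"
        by (intro mult_right_mono M) simp
      also have "\<dots> = M * exp (- (\<beta> - \<gamma>) * x)"
        by (simp add: mult.assoc algebra_simps flip: exp_add)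
      also have "\<dots> \<le> max 1 M * exp (- (\<beta> - \<gamma>) * x)"
        by (intro mult_right_mono) auto
      finally show ?thesis .
    next
      case False
      have "tail F x \<le> 1 * 1" by (simp add: tail_bounds)
      also have "\<dots> \<le> max 1 M * exp (- (\<beta> - \<gamma>) * x)"
        using False 3 by (intro mult_mono) (auto simp: zero_le_mult_iff)
      finally show ?thesis .
    qed
    then show False
      using class_D_no_exp_bound[OF FD, of "\<beta> - \<gamma>" "max 1 M"] 3 by simp
  qed
qed

theorem proposition1p3:
  fixes \<gamma> :: real and F G :: "real measure"
  assumes "\<gamma> > 0"
    and "is_tilt \<gamma> F G"
    and "F \<in> class_Df - class_S_star"
  shows "G \<in> (class_J \<inter> light_tailed) - (\<Union>\<beta>\<in>{0<..}. class_S \<beta>)"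
proof -
  have FD: "F \<in> class_D" and fm: "finite_mean F" using assms(3) by (auto simp: class_Df_def)
  have F: "F \<in> dists" using FD by (rule class_D_dists)
  have "exp_moment G \<gamma> \<noteq> \<infinity>"
    using is_tilt_exp_moment_finite[OF assms(1,2) F fm] by simp
  then have "G \<in> light_tailed"
    using is_tilt_dists[OF assms(2) F] assms(1) by (auto simp: light_tailed_def class_K_def)
  moreover have "G \<in> class_J" by (rule is_tilt_class_J[OF assms(1,2) FD fm])
  moreover have "G \<notin> class_S \<beta>" if "\<beta> > 0" for \<beta>
    by (rule is_tilt_not_class_S[OF assms that])
  ultimately show ?thesis by auto
qed
end
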